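(* Let $\mathcal I$ be an ideal on $\mathbb N$. Let $g:(0,\infty)\to(0,\infty)$ be a strictly increasing function and let $(b_n)_{n\in\mathbb N}$, $(c_n)_{n\in\mathbb N}$ be sequences of positive reals such that at least one of the following holds: (A) $\lim_{x\to 0^+} \frac{g(x)}{x^\gamma}=M$ for some constants $\gamma,M\in(0,\infty)$, and $\lim_{n\to\infty}c_n=\infty$; (B) $\lim_{x\to 0^+} g(x)=0$ and for every $\varepsilon>0$ there exists $M$ such that $\frac{g(x)}{g(\varepsilon x)}\leq M$ for all $x>0$. Then the following conditions are equivalent. (1) For every sequence $(a_n)_{n\in\mathbb N}$ with $a_n\in\mathrm{ran}(g)$ for all $n$: if $\sum_{n=1}^{\infty} b_n a_n<\infty$ then $\mathcal I^+\text{-}\lim c_n g^{-1}(a_n)=0$. (2) $\mathcal I_{(b_n g(1/c_n))}\cap \mathcal I^*=\emptyset$.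
   Context: $\mathbb N=\{1,2,\dots\}$. An ideal on $\mathbb N$ is a nonempty family $\mathcal I\subseteq\mathcal P(\mathbb N)$ closed under subsets and finite unions, containing all finite subsets of $\mathbb N$, with $\mathbb N\notin\mathcal I$. $\mathcal I^*=\{\mathbb N\setminus A: A\in\mathcal I\}$ is the dual filter and $\mathcal I^+=\{A\subseteq\mathbb N:A\notin\mathcal I\}$ is the coideal. For a real sequence $(x_n)$, $\mathcal I^+\text{-}\lim x_n=L$ means there is $A\in\mathcal I^+$ such that the subsequence $(x_n)_{n\in A}$ converges to $L$ in the ordinary sense (such an $L$ need not be unique). For a sequence $(d_n)$ of nonnegative reals, $\mathcal I_{(d_n)}=\{A\subseteq\mathbb N:\sum_{n\in A}d_n<\infty\}$. $\mathrm{ran}(g)$ is the range of $g$, and $g^{-1}:\mathrm{ran}(g)\to(0,\infty)$ is the inverse of the injective function $g$. *)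

theory Defs
  imports "HOL-Analysis.Analysis" "HOL-Library.Infinite_Set"
begin

text \<open>The underlying set is \<open>{1, 2, \<dots>}\<close>, encoded as a subset of \<^typ>\<open>nat\<close>; sequences are
  functions on \<^typ>\<open>nat\<close> whose value at \<open>0\<close> is irrelevant.\<close>

abbreviation posnat :: "nat set" where
  "posnat \<equiv> {1..}"

definition ideal_on_posnat :: "nat set set \<Rightarrow> bool" where
  "ideal_on_posnat I \<longleftrightarrow>
     I \<noteq> {} \<and> I \<subseteq> Pow posnat \<and>
     (\<forall>A\<in>I. \<forall>B\<subseteq>A. B \<in> I) \<and>
     (\<forall>A\<in>I. \<forall>B\<in>I. A \<union> B \<in> I) \<and>
     (\<forall>F\<subseteq>posnat. finite F \<longrightarrow> F \<in> I) \<and>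
     posnat \<notin> I"

definition dual_filter :: "nat set set \<Rightarrow> nat set set" where
  "dual_filter I = {posnat - A | A. A \<in> I}"

definition coideal :: "nat set set \<Rightarrow> nat set set" where
  "coideal I = {A. A \<subseteq> posnat \<and> A \<notin> I}"

text \<open>Members of the coideal of an ideal are infinite, so \<^const>\<open>enumerate\<close> lists them
  increasingly. The limit need not be unique, hence a relation.\<close>

definition coideal_lim :: "nat set set \<Rightarrow> (nat \<Rightarrow> real) \<Rightarrow> real \<Rightarrow> bool" where
  "coideal_lim I x L \<longleftrightarrow> (\<exists>A\<in>coideal I. (\<lambda>k. x (enumerate A k)) \<longlonglongrightarrow> L)"

text \<open>Intended for sequences nonnegative on \<^term>\<open>posnat\<close>, where \<open>summable_on\<close> means that the
  sum is finite.\<close>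

definition summable_ideal :: "(nat \<Rightarrow> real) \<Rightarrow> nat set set" where
  "summable_ideal d = {A. A \<subseteq> posnat \<and> d summable_on A}"

end

theory Submission
  imports Defs
begin

text \<open>
  Write \<open>d n = b n * g (1 / c n)\<close> and \<open>a n = g (x n)\<close>. Both (A) and (B) yield, for every \<open>\<epsilon> > 0\<close>,
  a constant \<open>K\<close> with \<open>g (1 / c n) \<le> K * g (\<epsilon> / c n)\<close> for almost all \<open>n\<close>. Hence if
  \<open>\<Sum> b n * a n\<close> converges, each set \<open>{n. c n * x n \<ge> \<epsilon>}\<close> lies in the summable ideal of \<open>d\<close>. As summable ideals
  are P-ideals, a single member \<open>E\<close> of that ideal almost contains all these sets, so \<open>c n * x n\<close> tends to
  \<open>0\<close> along the complement of \<open>E\<close>, which is in the coideal by (2). Conversely, if \<open>F\<close> is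
  in the dual filter and in the summable ideal of \<open>d\<close>, then taking \<open>x n = 1 / c n\<close> on \<open>F\<close> and
  \<open>x n\<close> tiny off \<open>F\<close> violates (1), since every coideal set meets \<open>F\<close> in an infinite set.
\<close>

section \<open>Subsequences along infinite sets, and unordered sums\<close>

lemma eventually_enumerate_iff:
  fixes A :: "nat set"
  assumes "infinite A"
  shows "(\<forall>\<^sub>F k in sequentially. P (enumerate A k)) \<longleftrightarrow> finite {n\<in>A. \<not> P n}"
proof -
  have bij: "bij_betw (enumerate A) UNIV A"
    using assms by (rule bij_enumerate)
  have "{n\<in>A. \<not> P n} = enumerate A ` {k. \<not> P (enumerate A k)}"
    using bij by (auto simp: bij_betw_def)
  moreover have "inj_on (enumerate A) {k. \<not> P (enumerate A k)}"
    using bij by (auto simp: bij_betw_def inj_on_def)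
  ultimately have "finite {n\<in>A. \<not> P n} \<longleftrightarrow> finite {k. \<not> P (enumerate A k)}"
    by (simp add: finite_image_iff)
  then show ?thesis
    by (simp add: eventually_cofinite flip: cofinite_eq_sequentially)
qed

text \<open>The finite partial sums converge to the infinite sum, so some \<open>F\<close> captures
  all but \<epsilon> of it. By nonnegativity, a finite set disjoint from \<open>F\<close> cannot add
  more than the missing amount.\<close>

lemma summable_on_nonneg_small_tail:
  fixes f :: "'a \<Rightarrow> real"
  assumes sm: "f summable_on E" and nn: "\<And>x. x \<in> E \<Longrightarrow> f x \<ge> 0" and "\<epsilon> > 0"
  obtains F where "finite F" "F \<subseteq> E" "\<And>G. finite G \<Longrightarrow> G \<subseteq> E - F \<Longrightarrow> sum f G \<le> \<epsilon>"
proof -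
  have "(sum f \<longlongrightarrow> infsum f E) (finite_subsets_at_top E)"
    using sm by (simp add: has_sum_def[symmetric])
  then have "\<forall>\<^sub>F F in finite_subsets_at_top E. sum f F > infsum f E - \<epsilon>"
    using \<open>\<epsilon> > 0\<close> by (intro order_tendstoD) auto
  then obtain F where F: "finite F" "F \<subseteq> E" "sum f F > infsum f E - \<epsilon>"
    unfolding eventually_finite_subsets_at_top by blast
  have "sum f G \<le> \<epsilon>" if G: "finite G" "G \<subseteq> E - F" for G
  proof -
    have "sum f F + sum f G = sum f (F \<union> G)"
      using F G by (intro sum.union_disjoint[symmetric]) auto
    also have "\<dots> \<le> infsum f E"
      using F G nn by (intro finite_sum_le_infsum sm) auto
    finally show ?thesis using F by simp
  qed
  with F that show thesis by blast
qed

text \<open>This is the P-ideal property of summable ideals: remove from each \<open>E k\<close> a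
  finite set \<open>F k\<close> so that the rest has sum at most \<open>(1/2) ^ k\<close>, and unite
  the rests.\<close>

lemma summable_on_pseudo_union:
  fixes f :: "'a \<Rightarrow> real" and E :: "nat \<Rightarrow> 'a set"
  assumes sm: "\<And>k. f summable_on E k" and nn: "\<And>k x. x \<in> E k \<Longrightarrow> f x \<ge> 0"
  obtains D where "f summable_on D" "D \<subseteq> (\<Union>k. E k)" "\<And>k. finite (E k - D)"
proof -
  have "\<exists>F. finite F \<and> F \<subseteq> E k \<and> (\<forall>G. finite G \<longrightarrow> G \<subseteq> E k - F \<longrightarrow> sum f G \<le> (1/2) ^ k)" for k
  proof (rule summable_on_nonneg_small_tail[of f "E k" "(1/2) ^ k"])
    show "f x \<ge> 0" if "x \<in> E k" for x
      using that by (rule nn)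
  qed (use sm in auto)
  then obtain F where F: "\<And>k. finite (F k)"
      "\<And>k G. finite G \<Longrightarrow> G \<subseteq> E k - F k \<Longrightarrow> sum f G \<le> (1/2) ^ k"
    by metis
  define D where "D = (\<Union>k. E k - F k)"
  have nnD: "f x \<ge> 0" if "x \<in> D" for x
    using that nn unfolding D_def by blast
  have "sum f G \<le> 2" if G: "finite G" "G \<subseteq> D" for G
  proof -
    have "\<forall>x\<in>G. \<exists>k. x \<in> E k - F k"
      using G(2) unfolding D_def by blast
    then obtain h where h: "\<forall>x\<in>G. x \<in> E (h x) - F (h x)"
      by metis
    define J where "J = h ` G"
    have J: "finite J" "G \<subseteq> (\<Union>k\<in>J. E k - F k)"
      unfolding J_def using G(1) h by auto
    have "sum f G \<le> sum f (\<Union>k\<in>J. G \<inter> (E k - F k))"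
      using J G nnD by (intro sum_mono2) auto
    \<comment> \<open>The pieces may overlap, so this is only an inequality: elements counted
      several times contribute nonnegative amounts.\<close>
    also have "\<dots> \<le> (\<Sum>k\<in>J. sum f (G \<inter> (E k - F k)))"
      using \<open>finite J\<close>
    proof (induction J rule: finite_induct)
      case (insert k J)
      let ?A = "G \<inter> (E k - F k)" and ?B = "\<Union>k\<in>J. G \<inter> (E k - F k)"
      have "finite ?A" "finite ?B" "sum f (?A \<inter> ?B) \<ge> 0"
        using G nnD insert.hyps by (auto intro: sum_nonneg)
      then have "sum f (?A \<union> ?B) \<le> sum f ?A + sum f ?B"
        by (simp add: sum_Un)
      with insert show ?case by simp
    qed simp
    also have "\<dots> \<le> (\<Sum>k\<in>J. (1/2) ^ k)"
      using G by (intro sum_mono F(2)) auto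
    also have "\<dots> \<le> (\<Sum>k. (1/2) ^ k)"
      using J by (intro sum_le_suminf) auto
    also have "\<dots> = 2"
      by (simp add: suminf_geometric)
    finally show ?thesis .
  qed
  then have "f summable_on D"
    using nnD by (intro nonneg_bdd_above_summable_on bdd_aboveI[of _ 2]) auto
  moreover have "finite (E k - D)" for k
    by (rule finite_subset[OF _ F(1)[of k]]) (auto simp: D_def)
  moreover have "D \<subseteq> (\<Union>k. E k)"
    by (auto simp: D_def)
  ultimately show thesis using that by blast
qed

text \<open>For nonnegative terms, ordered and unordered summability agree; this links the series in
  condition (1) to the sums over sets in \<open>summable_ideal\<close>.\<close>

lemma summable_on_posnat_iff:
  fixes f :: "nat \<Rightarrow> real"
  assumes "\<And>n. n \<in> posnat \<Longrightarrow> f n \<ge> 0"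
  shows "f summable_on posnat \<longleftrightarrow> summable (\<lambda>n. f (Suc n))"
proof -
  have "posnat = range Suc"
    by (auto simp: image_iff Suc_le_eq gr0_conv_Suc)
  then have "f summable_on posnat \<longleftrightarrow> (f \<circ> Suc) summable_on UNIV"
    by (simp add: summable_on_reindex)
  also have "\<dots> \<longleftrightarrow> summable (f \<circ> Suc)"
    using assms by (intro summable_on_UNIV_nonneg_real_iff) auto
  finally show ?thesis by (simp add: o_def)
qed

section \<open>Ideals, coideals and dual filters\<close>

lemma ideal_on_posnatD:
  assumes "ideal_on_posnat I"
  shows "\<And>A B. A \<in> I \<Longrightarrow> B \<subseteq> A \<Longrightarrow> B \<in> I"
    and "\<And>A B. A \<in> I \<Longrightarrow> B \<in> I \<Longrightarrow> A \<union> B \<in> I"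
    and "\<And>F. F \<subseteq> posnat \<Longrightarrow> finite F \<Longrightarrow> F \<in> I"
  using assms unfolding ideal_on_posnat_def by simp_all

lemma coideal_infinite:
  assumes "ideal_on_posnat I" "A \<in> coideal I"
  shows "infinite A"
  using ideal_on_posnatD(3)[OF assms(1)] assms(2) by (auto simp: coideal_def)

text \<open>If \<open>F\<close> is the complement of \<open>B\<close> in the ideal, then
  \<open>A\<close> is covered by \<open>A \<inter> F\<close> and \<open>B\<close>; a finite
  intersection would put \<open>A\<close> into the ideal.\<close>

lemma coideal_Int_dual_filter_infinite:
  assumes I: "ideal_on_posnat I" and A: "A \<in> coideal I" and F: "F \<in> dual_filter I"
  shows "infinite (A \<inter> F)"
proof
  assume fin: "finite (A \<inter> F)"
  obtain B where B: "B \<in> I" "F = posnat - B"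
    using F by (auto simp: dual_filter_def)
  have sub: "A \<subseteq> posnat" "A \<notin> I" using A by (simp_all add: coideal_def)
  then have "A \<inter> F \<in> I"
    using fin by (intro ideal_on_posnatD(3)[OF I]) auto
  with B(1) have "A \<inter> F \<union> B \<in> I"
    by (intro ideal_on_posnatD(2)[OF I])
  moreover have "A \<subseteq> A \<inter> F \<union> B" using B(2) sub by auto
  ultimately show False
    using sub ideal_on_posnatD(1)[OF I] by blast
qed

section \<open>Behaviour of \<open>g\<close> near 0 and under dilation\<close>

lemma tendsto_0_of_power_asymptotics:
  fixes g :: "real \<Rightarrow> real"
  assumes "\<gamma> > 0" and "((\<lambda>x. g x / x powr \<gamma>) \<longlongrightarrow> M) (at_right 0)"
  shows "(g \<longlongrightarrow> 0) (at_right 0)"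
proof -
  have "((\<lambda>x::real. x powr \<gamma>) \<longlongrightarrow> 0 powr \<gamma>) (at_right 0)"
    using assms(1) by (intro tendsto_powr2) (auto intro!: eventually_at_rightI[of 0 1])
  then have "((\<lambda>x. g x / x powr \<gamma> * x powr \<gamma>) \<longlongrightarrow> M * 0) (at_right 0)"
    using assms by (intro tendsto_mult) auto
  moreover have "\<forall>\<^sub>F x in at_right 0. g x / x powr \<gamma> * x powr \<gamma> = g x"
    by (intro eventually_at_rightI[of 0 1]) auto
  ultimately show ?thesis
    by (simp add: tendsto_cong)
qed

text \<open>Normalise numerator and denominator by \<open>x powr \<gamma>\<close> and
  \<open>(\<epsilon> * x) powr \<gamma>\<close>: both quotients tend to \<open>M\<close>, which is
  nonzero, and only the factor \<open>1 / \<epsilon> powr \<gamma>\<close> survives.\<close>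

lemma dilation_ratio_tendsto:
  fixes g :: "real \<Rightarrow> real"
  assumes lim: "((\<lambda>x. g x / x powr \<gamma>) \<longlongrightarrow> M) (at_right 0)" and "M > 0" "\<epsilon> > 0"
  shows "((\<lambda>x. g x / g (\<epsilon> * x)) \<longlongrightarrow> 1 / \<epsilon> powr \<gamma>) (at_right 0)"
proof -
  have "filterlim (\<lambda>x. \<epsilon> * x) (at_right 0) (at_right 0)"
    unfolding filterlim_at using \<open>\<epsilon> > 0\<close>
    by (auto intro!: eventually_at_rightI[of 0 1] tendsto_eq_intros)
  then have "((\<lambda>x. g (\<epsilon> * x) / (\<epsilon> * x) powr \<gamma>) \<longlongrightarrow> M) (at_right 0)"
    by (rule filterlim_compose[OF lim])
  then have "((\<lambda>x. (g x / x powr \<gamma>) / (g (\<epsilon> * x) / (\<epsilon> * x) powr \<gamma>) * (1 / \<epsilon> powr \<gamma>))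
      \<longlongrightarrow> M / M * (1 / \<epsilon> powr \<gamma>)) (at_right 0)"
    using lim \<open>M > 0\<close> by (intro tendsto_intros) auto
  moreover have "\<forall>\<^sub>F x in at_right 0.
      (g x / x powr \<gamma>) / (g (\<epsilon> * x) / (\<epsilon> * x) powr \<gamma>) * (1 / \<epsilon> powr \<gamma>) = g x / g (\<epsilon> * x)"
    using \<open>\<epsilon> > 0\<close> by (intro eventually_at_rightI[of 0 1]) (auto simp: powr_mult)
  ultimately show ?thesis
    using \<open>M > 0\<close> by (simp add: tendsto_cong)
qed

text \<open>The common consequence of (A) and (B) used in the proof that (2) implies (1). Under (A)
  the ratio is controlled only near 0, which is why \<open>c\<close> must tend to infinity and the
  bound is only eventual.\<close>

lemma eventually_dilation_bound:
  fixes g :: "real \<Rightarrow> real" and c :: "nat \<Rightarrow> real"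
  assumes gpos: "\<And>x. x > 0 \<Longrightarrow> g x > 0"
    and cpos: "\<forall>n\<in>posnat. c n > 0"
    and AB: "((\<exists>\<gamma>>0. \<exists>M>0. ((\<lambda>x. g x / x powr \<gamma>) \<longlongrightarrow> M) (at_right 0)) \<and> filterlim c at_top sequentially)
       \<or> ((g \<longlongrightarrow> 0) (at_right 0) \<and> (\<forall>\<epsilon>>0. \<exists>M. \<forall>x>0. g x / g (\<epsilon> * x) \<le> M))"
    and "\<epsilon> > 0"
  obtains K where "\<forall>\<^sub>F n in sequentially. g (1 / c n) \<le> K * g (\<epsilon> / c n)"
proof -
  have pos: "\<forall>\<^sub>F n in sequentially. c n > 0"
    using cpos unfolding eventually_sequentially by auto
  have "\<exists>K. \<forall>\<^sub>F n in sequentially. g (1 / c n) / g (\<epsilon> * (1 / c n)) \<le> K"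
    using AB
  proof (elim disjE conjE exE)
    fix \<gamma> M :: real
    assume M: "M > 0" and lim: "((\<lambda>x. g x / x powr \<gamma>) \<longlongrightarrow> M) (at_right 0)"
      and c: "filterlim c at_top sequentially"
    have "filterlim (\<lambda>n. 1 / c n) (at_right 0) sequentially"
      using filterlim_compose[OF filterlim_inverse_at_right_top c] by (simp add: inverse_eq_divide)
    then have "(\<lambda>n. g (1 / c n) / g (\<epsilon> * (1 / c n))) \<longlonglongrightarrow> 1 / \<epsilon> powr \<gamma>"
      by (rule filterlim_compose[OF dilation_ratio_tendsto[OF lim M \<open>\<epsilon> > 0\<close>]])
    then have "\<forall>\<^sub>F n in sequentially. g (1 / c n) / g (\<epsilon> * (1 / c n)) < 1 / \<epsilon> powr \<gamma> + 1"
      by (rule order_tendstoD) simp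
    then show ?thesis
      by (intro exI) (erule eventually_mono, rule less_imp_le)
  next
    assume "\<forall>\<epsilon>>0. \<exists>M. \<forall>x>0. g x / g (\<epsilon> * x) \<le> M"
    then obtain K where K: "\<forall>x>0. g x / g (\<epsilon> * x) \<le> K"
      using \<open>\<epsilon> > 0\<close> by blast
    show ?thesis
    proof (intro exI eventually_mono[OF pos])
      fix n assume "c n > 0"
      then show "g (1 / c n) / g (\<epsilon> * (1 / c n)) \<le> K"
        using K by (metis zero_less_divide_1_iff)
    qed
  qed
  then obtain K where K: "\<forall>\<^sub>F n in sequentially. g (1 / c n) / g (\<epsilon> * (1 / c n)) \<le> K"
    by blast
  have "\<forall>\<^sub>F n in sequentially. g (1 / c n) \<le> K * g (\<epsilon> / c n)"
    using K pos
  proof eventually_elim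
    case (elim n)
    then have "g (\<epsilon> / c n) > 0" using gpos \<open>\<epsilon> > 0\<close> by simp
    with elim show ?case by (simp add: pos_divide_le_eq)
  qed
  then show thesis using that by blast
qed

text \<open>The superlevel sets for the thresholds \<open>1 / (k + 1)\<close> are almost contained
  in one set \<open>D\<close> of the summable ideal. Since \<open>D\<close> is not in the dual
  filter, its complement is in the coideal, and \<open>z\<close> tends to 0 along it.\<close>

lemma coideal_lim_of_superlevel_summable:
  fixes d z :: "nat \<Rightarrow> real"
  assumes I: "ideal_on_posnat I"
    and disj: "summable_ideal d \<inter> dual_filter I = {}"
    and d: "\<And>n. n \<in> posnat \<Longrightarrow> d n \<ge> 0"
    and sm: "\<And>\<epsilon>. \<epsilon> > 0 \<Longrightarrow> d summable_on {n\<in>posnat. \<bar>z n\<bar> \<ge> \<epsilon>}"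
  shows "coideal_lim I z 0"
proof -
  define E where "E k = {n\<in>posnat. \<bar>z n\<bar> \<ge> inverse (real (Suc k))}" for k
  have "d summable_on E k" for k
    unfolding E_def by (rule sm) simp
  moreover have "d n \<ge> 0" if "n \<in> E k" for k n
    using that d by (simp add: E_def)
  ultimately obtain D where D: "d summable_on D" "D \<subseteq> (\<Union>k. E k)" "\<And>k. finite (E k - D)"
    using summable_on_pseudo_union[of d E] by metis
  have Dpos: "D \<subseteq> posnat" using D(2) by (auto simp: E_def)
  have "posnat - D \<in> coideal I"
  proof -
    have "D \<notin> dual_filter I"
      using disj D(1) Dpos by (auto simp: summable_ideal_def)
    then have "posnat - D \<notin> I"
      using Dpos unfolding dual_filter_def by blast
    then show ?thesis by (simp add: coideal_def)
  qed
  moreover have "(\<lambda>k. z (enumerate (posnat - D) k)) \<longlonglongrightarrow> 0"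
  proof (rule tendstoI)
    fix e :: real assume "e > 0"
    then obtain k where k: "inverse (real (Suc k)) < e"
      using reals_Archimedean by blast
    \<comment> \<open>Every exceptional \<open>n\<close> has \<open>\<bar>z n\<bar> \<ge> e\<close>,
      hence lies in \<open>E k - D\<close>.\<close>
    have "finite {n \<in> posnat - D. \<not> dist (z n) 0 < e}"
      by (rule finite_subset[OF _ D(3)[of k]]) (use k in \<open>auto simp: E_def\<close>)
    with coideal_infinite[OF I \<open>posnat - D \<in> coideal I\<close>]
    show "\<forall>\<^sub>F k in sequentially. dist (z (enumerate (posnat - D) k)) 0 < e"
      using eventually_enumerate_iff[of "posnat - D" "\<lambda>n. dist (z n) 0 < e"] by blast
  qed
  ultimately show ?thesis
    unfolding coideal_lim_def by blast
qed

section \<open>The equivalence of (1) and (2)\<close>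

theorem theorem2p7:
  fixes I :: "nat set set" and g :: "real \<Rightarrow> real" and b c :: "nat \<Rightarrow> real"
  assumes "ideal_on_posnat I"
    and "g ` {0<..} \<subseteq> {0<..}"
    and "strict_mono_on {0<..} g"
    and "\<forall>n\<in>posnat. b n > 0"
    and "\<forall>n\<in>posnat. c n > 0"
    and "((\<exists>\<gamma>>0. \<exists>M>0. ((\<lambda>x. g x / x powr \<gamma>) \<longlongrightarrow> M) (at_right 0)) \<and> filterlim c at_top sequentially)
       \<or> ((g \<longlongrightarrow> 0) (at_right 0) \<and> (\<forall>\<epsilon>>0. \<exists>M. \<forall>x>0. g x / g (\<epsilon> * x) \<le> M))"
  shows "(\<forall>a :: nat \<Rightarrow> real. (\<forall>n\<in>posnat. a n \<in> g ` {0<..}) \<longrightarrow>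
            summable (\<lambda>n. b (Suc n) * a (Suc n)) \<longrightarrow>
            coideal_lim I (\<lambda>n. c n * the_inv_into {0<..} g (a n)) 0)
         \<longleftrightarrow> summable_ideal (\<lambda>n. b n * g (1 / c n)) \<inter> dual_filter I = {}"
proof -
  note I = assms(1) and bpos = assms(4) and cpos = assms(5)
  have gpos: "g x > 0" if "x > 0" for x
    using assms(2) that by auto
  have inj: "inj_on g {0<..}"
    using assms(3) by (rule strict_mono_on_imp_inj_on)
  have ginv: "the_inv_into {0<..} g (g x) = x" if "x > 0" for x
    using the_inv_into_f_f[OF inj] that by simp
  have gmono: "g x \<le> g y" if "0 < x" "x \<le> y" for x y
    using strict_mono_on_leD[OF assms(3)] that by simp
  have g0: "(g \<longlongrightarrow> 0) (at_right 0)"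
    using assms(6) tendsto_0_of_power_asymptotics by blast
  show ?thesis
  proof (intro iffI allI impI)
    fix a :: "nat \<Rightarrow> real"
    assume disj: "summable_ideal (\<lambda>n. b n * g (1 / c n)) \<inter> dual_filter I = {}"
      and a: "\<forall>n\<in>posnat. a n \<in> g ` {0<..}" and sma: "summable (\<lambda>n. b (Suc n) * a (Suc n))"
    define x where "x n = the_inv_into {0<..} g (a n)" for n
    have x: "x n > 0" "g (x n) = a n" if "n \<in> posnat" for n
      using a that ginv unfolding x_def by force+
    have ba: "b n * a n \<ge> 0" if "n \<in> posnat" for n
      using that bpos x gpos by (metis less_imp_le mult_nonneg_nonneg)
    have sba: "(\<lambda>n. b n * a n) summable_on posnat"
      using summable_on_posnat_iff[of "\<lambda>n. b n * a n"] ba sma by simp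
    have "coideal_lim I (\<lambda>n. c n * x n) 0"
    proof (rule coideal_lim_of_superlevel_summable[OF I disj])
      show "b n * g (1 / c n) \<ge> 0" if "n \<in> posnat" for n
        using that bpos cpos gpos by (simp add: less_imp_le)
      fix \<epsilon> :: real assume "\<epsilon> > 0"
      then obtain K where "\<forall>\<^sub>F n in sequentially. g (1 / c n) \<le> K * g (\<epsilon> / c n)"
        using eventually_dilation_bound[OF gpos cpos assms(6)] by blast
      then obtain N where N: "\<And>n. n \<ge> N \<Longrightarrow> g (1 / c n) \<le> K * g (\<epsilon> / c n)"
        unfolding eventually_sequentially by blast
      let ?E = "{n\<in>posnat. \<bar>c n * x n\<bar> \<ge> \<epsilon>}"
      \<comment> \<open>The dilation bound holds only from \<open>N\<close> on; the finitely many
        smaller indices are added afterwards.\<close>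
      have "(\<lambda>n. b n * g (1 / c n)) summable_on (?E \<inter> {N..})"
      proof (rule summable_on_comparison_test)
        show "(\<lambda>n. \<bar>K\<bar> * (b n * a n)) summable_on (?E \<inter> {N..})"
          by (intro summable_on_cmult_right summable_on_subset_banach[OF sba]) auto
        fix n assume n: "n \<in> ?E \<inter> {N..}"
        then have pos: "n \<in> posnat" "b n > 0" "c n > 0" "x n > 0"
          using bpos cpos x by auto
        \<comment> \<open>By monotonicity of \<open>g\<close> this gives
          \<open>g (\<epsilon> / c n) \<le> a n\<close>, so \<open>b n * a n\<close> dominates up to
          a constant.\<close>
        with n have le: "\<epsilon> / c n \<le> x n"
          by (simp add: pos_divide_le_eq mult.commute)
        have "g (1 / c n) \<le> K * g (\<epsilon> / c n)"
          using n N by simp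
        \<comment> \<open>The sign of \<open>K\<close> is not recorded, and the next estimate needs
          a nonnegative factor.\<close>
        also have "\<dots> \<le> \<bar>K\<bar> * g (\<epsilon> / c n)"
          using gpos[of "\<epsilon> / c n"] pos \<open>\<epsilon> > 0\<close> by (intro mult_right_mono) auto
        also have "\<dots> \<le> \<bar>K\<bar> * a n"
          using gmono[OF _ le] pos \<open>\<epsilon> > 0\<close> x(2)[OF pos(1)] by (intro mult_left_mono) auto
        finally show "b n * g (1 / c n) \<le> \<bar>K\<bar> * (b n * a n)"
          using pos by (simp add: mult.left_commute)
        show "0 \<le> b n * g (1 / c n)"
          using pos gpos[of "1 / c n"] by simp
      qed
      moreover have "finite (?E \<inter> {..<N})"
        by simp
      then have "(\<lambda>n. b n * g (1 / c n)) summable_on (?E \<inter> {..<N})"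
        by (rule summable_on_finite)
      ultimately have "(\<lambda>n. b n * g (1 / c n)) summable_on (?E \<inter> {N..} \<union> ?E \<inter> {..<N})"
        by (rule summable_on_Un_disjoint) auto
      moreover have "?E \<inter> {N..} \<union> ?E \<inter> {..<N} = ?E"
        by auto
      ultimately show "(\<lambda>n. b n * g (1 / c n)) summable_on ?E"
        by simp
    qed
    then show "coideal_lim I (\<lambda>n. c n * the_inv_into {0<..} g (a n)) 0"
      by (simp add: x_def)
  next
    assume conv: "\<forall>a :: nat \<Rightarrow> real. (\<forall>n\<in>posnat. a n \<in> g ` {0<..}) \<longrightarrow>
            summable (\<lambda>n. b (Suc n) * a (Suc n)) \<longrightarrow>
            coideal_lim I (\<lambda>n. c n * the_inv_into {0<..} g (a n)) 0"
    show "summable_ideal (\<lambda>n. b n * g (1 / c n)) \<inter> dual_filter I = {}"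
    proof (rule equals0I)
      fix F assume "F \<in> summable_ideal (\<lambda>n. b n * g (1 / c n)) \<inter> dual_filter I"
      then have Fpos: "F \<subseteq> posnat" and smF: "(\<lambda>n. b n * g (1 / c n)) summable_on F"
        and Fdual: "F \<in> dual_filter I"
        by (auto simp: summable_ideal_def)
      \<comment> \<open>As \<open>g\<close> tends to 0 at 0, the terms off \<open>F\<close> can be
        put under a geometric series, however large \<open>b n\<close> is.\<close>
      have "\<exists>t>0. b n * g t \<le> (1/2) ^ n" if "n \<in> posnat" for n
      proof -
        have "b n > 0" using bpos that by blast
        then have "\<forall>\<^sub>F t in at_right 0. g t < (1/2) ^ n / b n"
          by (intro order_tendstoD(2)[OF g0]) simp
        then have "\<forall>\<^sub>F t in at_right 0. t > 0 \<and> g t < (1/2) ^ n / b n"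
          using eventually_at_right_less[of "0::real"] by eventually_elim simp
        then obtain t where "t > 0" "g t < (1/2) ^ n / b n"
          using eventually_happens'[OF trivial_limit_at_right_real] by blast
        with \<open>b n > 0\<close> show ?thesis
          by (auto simp: pos_less_divide_eq mult.commute intro: less_imp_le)
      qed
      then obtain t where t: "\<And>n. n \<in> posnat \<Longrightarrow> t n > 0"
          "\<And>n. n \<in> posnat \<Longrightarrow> b n * g (t n) \<le> (1/2) ^ n"
        by metis
      \<comment> \<open>On \<open>F\<close> the terms of the series are the summable weights
        themselves, while \<open>c n * x n = 1\<close> there keeps the sequence away from 0.\<close>
      define x where "x n = (if n \<in> F then 1 / c n else t n)" for n
      have x: "x n > 0" if "n \<in> posnat" for n
        using that t cpos by (auto simp: x_def)
      have bgx: "b n * g (x n) \<ge> 0" if "n \<in> posnat" for n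
        using that bpos gpos[OF x] by (simp add: less_imp_le)
      have "(\<lambda>n. b n * g (x n)) summable_on (posnat - F)"
      proof (rule summable_on_comparison_test)
        have "(\<lambda>n. (1/2) ^ n :: real) summable_on UNIV"
          by (subst summable_on_UNIV_nonneg_real_iff) auto
        then show "(\<lambda>n. (1/2) ^ n :: real) summable_on (posnat - F)"
          by (rule summable_on_subset_banach) auto
        fix n assume "n \<in> posnat - F"
        then show "b n * g (x n) \<le> (1/2) ^ n" "b n * g (x n) \<ge> 0"
          using bgx[of n] t(2)[of n] by (simp_all add: x_def)
      qed
      moreover have "(\<lambda>n. b n * g (x n)) summable_on F"
        using smF by (rule summable_on_cong[THEN iffD1, rotated]) (simp add: x_def)
      ultimately have "(\<lambda>n. b n * g (x n)) summable_on ((posnat - F) \<union> F)"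
        by (rule summable_on_Un_disjoint) auto
      moreover have "(posnat - F) \<union> F = posnat" using Fpos by auto
      ultimately have "summable (\<lambda>n. b (Suc n) * g (x (Suc n)))"
        using summable_on_posnat_iff[of "\<lambda>n. b n * g (x n)"] bgx by simp
      then have "coideal_lim I (\<lambda>n. c n * the_inv_into {0<..} g (g (x n))) 0"
        using conv x by simp
      then obtain B where B: "B \<in> coideal I"
        and lim: "(\<lambda>k. c (enumerate B k) * the_inv_into {0<..} g (g (x (enumerate B k)))) \<longlonglongrightarrow> 0"
        unfolding coideal_lim_def by blast
      have "\<forall>\<^sub>F k in sequentially. c (enumerate B k) * the_inv_into {0<..} g (g (x (enumerate B k))) < 1"
        using lim by (rule order_tendstoD) simp
      then have "finite {n\<in>B. \<not> c n * the_inv_into {0<..} g (g (x n)) < 1}"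
        using eventually_enumerate_iff[OF coideal_infinite[OF I B],
            of "\<lambda>n. c n * the_inv_into {0<..} g (g (x n)) < 1"] by blast
      \<comment> \<open>The product equals 1 on \<open>F\<close>, so convergence to 0 along
        \<open>B\<close> leaves only finitely many elements of \<open>F\<close> in
        \<open>B\<close>.\<close>
      moreover have "B \<inter> F \<subseteq> {n\<in>B. \<not> c n * the_inv_into {0<..} g (g (x n)) < 1}"
      proof safe
        fix n assume n: "n \<in> F" "c n * the_inv_into {0<..} g (g (x n)) < 1"
        then have "n \<in> posnat" using Fpos by blast
        then have "c n > 0" "the_inv_into {0<..} g (g (x n)) = x n"
          using cpos ginv[OF x] by auto
        with n show False by (simp add: x_def)
      qed
      ultimately have "finite (B \<inter> F)"
        using finite_subset by blast
      with coideal_Int_dual_filter_infinite[OF I B Fdual] show False by blast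
    qed
  qed
qed

end
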